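(* Let $\mathbb{F}$ be a field and let $A\in SL_2(\mathbb{F})$ be a simple matrix or a scalar matrix. Consider the matrix equation $X^2=A$. (a) There is a solution $X\in SL_2(\mathbb{F})$ if and only if $\operatorname{tr}A+2$ is a quadratic element in $\mathbb{F}$ or $0$. (b) There is a solution $X\in ESL_2(\mathbb{F})$ if and only if $\operatorname{tr}A\pm 2$ (for at least one choice of sign) is a quadratic element in $\mathbb{F}$ or $0$. (c) This solution $X$ lies in $ESL_2(\mathbb{F})\setminus SL_2(\mathbb{F})$ if and only if $\operatorname{tr}A-2$ is a quadratic element or $0$ in $\mathbb{F}$ but $\operatorname{tr}A+2$ is not. (d) Conversely, $X\in SL_2(\mathbb{F})$ if and only if $\operatorname{tr}A+2$ is a quadratic element. (e) Solutions belong to both $ESL_2(\mathbb{F})$ and $SL_2(\mathbb{F})$ (that is, roots occur both in $ESL_2(\mathbb{F})\setminus SL_2(\mathbb{F})$ and in $SL_2(\mathbb{F})$) if and only if $\operatorname{tr}A+2$ and $\operatorname{tr}A-2$ are quadratic elements. (f) In the case $A\in GL_2(\mathbb{F})$ (with $A$ simple or scalar), the condition in (a), now for the existence of a solution in $GL_2(\mathbb{F})$, takes the form: $\operatorname{tr}A\pm 2\sqrt{\det A}$ (for at least one choice of sign) is a quadratic element in $\mathbb{F}$ or $0$, and $\det A$ is a quadratic element.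
   Context: $ESL_2(\mathbb{F})=\{M\in GL_2(\mathbb{F}) : \det M=\pm 1\}$ is the extended special linear group. A $2\times 2$ matrix over $\mathbb{F}$ is simple if its characteristic polynomial is separable, i.e. has two distinct roots in an algebraic closure of $\mathbb{F}$. A scalar matrix is a matrix $\lambda E$ with $\lambda\in\mathbb{F}$, where $E$ is the identity matrix. A quadratic element of $\mathbb{F}$ is a nonzero square in $\mathbb{F}$ (over $\mathbb{F}_p$: an element with Legendre symbol $1$); the value $0$ is allowed only where "or $0$" is written. $\sqrt{\det A}$ denotes an element of $\mathbb{F}$ whose square is $\det A$.
   Formalization: Part (d) is stated for tr A + 2 ≠ 0 (it fails for A = −E), and part (e) for characteristic ≠ 2 with tr A + 2 ≠ 0 and tr A − 2 ≠ 0 (it fails for A = E, and in characteristic 2, where ESL_2 = SL_2). *)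

theory Defs
  imports "HOL-Analysis.Determinants" "HOL-Algebra.Algebraic_Closure_Type"
begin

definition GL2 :: "('a::field^2^2) set" where
  "GL2 = {M. invertible M}"

definition SL2 :: "('a::field^2^2) set" where
  "SL2 = {M \<in> GL2. det M = 1}"

definition ESL2 :: "('a::field^2^2) set" where
  "ESL2 = {M \<in> GL2. det M = 1 \<or> det M = - 1}"

text \<open>The characteristic polynomial \<open>det (x E - A)\<close>, as a determinant over the polynomial ring.\<close>

definition charpoly :: "'a::field^'n^'n \<Rightarrow> 'a poly" where
  "charpoly A = det (mat [:0, 1:] - (\<chi> i j. [:A $ i $ j:]))"

text \<open>The type \<open>'a alg_closure\<close> is an algebraic closure of \<open>'a\<close>, with embedding \<open>to_ac\<close>.\<close>

definition simple_matrix :: "'a::field^2^2 \<Rightarrow> bool" where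
  "simple_matrix A \<longleftrightarrow>
     (\<exists>x y :: 'a alg_closure. x \<noteq> y \<and>
        poly (map_poly to_ac (charpoly A)) x = 0 \<and> poly (map_poly to_ac (charpoly A)) y = 0)"

definition scalar_matrix :: "'a::field^'n^'n \<Rightarrow> bool" where
  "scalar_matrix A \<longleftrightarrow> (\<exists>c. A = mat c)"

text \<open>Zero is a square but not a quadratic element.\<close>

definition quadratic_element :: "'a::field \<Rightarrow> bool" where
  "quadratic_element a \<longleftrightarrow> a \<noteq> 0 \<and> (\<exists>b. b\<^sup>2 = a)"

lemma GL2_iff_det: "M \<in> GL2 \<longleftrightarrow> det M \<noteq> 0"
  by (simp add: GL2_def invertible_det_nz)

lemma mat2_eq_iff:
  "(M :: 'a^2^2) = N \<longleftrightarrow>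
     M $ 1 $ 1 = N $ 1 $ 1 \<and> M $ 1 $ 2 = N $ 1 $ 2 \<and> M $ 2 $ 1 = N $ 2 $ 1 \<and> M $ 2 $ 2 = N $ 2 $ 2"
  by (auto simp: vec_eq_iff forall_2)

lemma trace_2: "trace (M :: 'a::comm_ring_1^2^2) = M $ 1 $ 1 + M $ 2 $ 2"
  by (simp add: trace_def sum_2)

text \<open>
  The criteria for roots in \<open>SL2\<close>, and for roots in both \<open>SL2\<close> and \<open>ESL2 - SL2\<close>, that ask for
  quadratic elements without allowing 0 need side conditions. If \<open>2 \<noteq> 0\<close>, the matrix \<open>-E\<close> has
  a root in \<open>SL2\<close> although \<open>tr (-E) + 2 = 0\<close>, and \<open>E\<close> has roots of both kinds although
  \<open>tr E - 2 = 0\<close>. In characteristic 2 there are no matrices of determinant -1 outside \<open>SL2\<close>.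
\<close>

lemma minus_id_root_SL2:
  shows "\<exists>Y \<in> SL2. Y ** Y = mat (- 1 :: 'a::field)"
    and "trace (mat (- 1) :: 'a^2^2) + 2 = 0"
proof -
  let ?Y = "vector [vector [0, 1], vector [- 1, 0]] :: 'a^2^2"
  have "?Y \<in> SL2" "?Y ** ?Y = mat (- 1)"
    by (simp_all add: SL2_def GL2_iff_det det_2 mat2_eq_iff matrix_matrix_mult_def sum_2 mat_def)
  then show "\<exists>Y \<in> SL2. Y ** Y = mat (- 1 :: 'a::field)" by blast
  show "trace (mat (- 1) :: 'a^2^2) + 2 = 0" by (simp add: trace_2 mat_def)
qed

lemma id_roots_SL2_ESL2:
  assumes "(2 :: 'a::field) \<noteq> 0"
  shows "\<exists>Y \<in> SL2. Y ** Y = (mat 1 :: 'a^2^2)"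
    and "\<exists>Y \<in> ESL2 - SL2. Y ** Y = (mat 1 :: 'a^2^2)"
    and "trace (mat 1 :: 'a^2^2) - 2 = 0"
proof -
  let ?Y = "vector [vector [1, 0], vector [0, - 1]] :: 'a^2^2"
  have "(1::'a) \<noteq> - 1"
    using assms by (metis add.right_inverse one_add_one)
  then have "?Y \<in> ESL2 - SL2" "?Y ** ?Y = mat 1"
    by (simp_all add: SL2_def ESL2_def GL2_iff_det det_2 mat2_eq_iff matrix_matrix_mult_def sum_2 mat_def)
  then show "\<exists>Y \<in> ESL2 - SL2. Y ** Y = (mat 1 :: 'a^2^2)" by blast
  show "\<exists>Y \<in> SL2. Y ** Y = (mat 1 :: 'a^2^2)"
    by (rule bexI[of _ "mat 1"]) (simp_all add: SL2_def GL2_iff_det)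
  show "trace (mat 1 :: 'a^2^2) - 2 = 0" by (simp add: trace_2 mat_def)
qed

lemma ESL2_eq_SL2_char_2:
  assumes "(2 :: 'a::field) = 0"
  shows "(ESL2 :: ('a^2^2) set) = SL2"
proof -
  have "(- 1 :: 'a) = 1"
    using assms by (metis add_eq_0_iff one_add_one)
  then show ?thesis by (auto simp: SL2_def ESL2_def)
qed

end

theory Submission
  imports Defs
begin

text \<open>
  By Cayley--Hamilton, a root \<open>Y\<close> of \<open>A\<close> with determinant \<open>s\<close> satisfies \<open>A = (tr Y) Y - s E\<close>, so
  \<open>s\<^sup>2 = det A\<close> and \<open>tr A + 2 s = (tr Y)\<^sup>2\<close>. Conversely, if \<open>s\<^sup>2 = det A\<close> and \<open>tr A + 2 s = t\<^sup>2\<close> with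
  \<open>t \<noteq> 0\<close>, then \<open>(A + s E) / t\<close> is a root with determinant \<open>s\<close>. If \<open>t = 0\<close>, then \<open>-s\<close> is a double
  eigenvalue, so \<open>A\<close> is the scalar matrix \<open>-s E\<close>, which has a trace-zero root of determinant \<open>s\<close>.
  All the criteria are instances of this one with \<open>s\<close> prescribed.
\<close>

lemma charpoly_2: "charpoly (A :: 'a::field^2^2) = [:det A, - trace A, 1:]"
  by (simp add: charpoly_def det_2 trace_2 mat_def algebra_simps)

text \<open>If the sum vanished, the characteristic polynomial would be (x + s)^2, with the single
  root -s in the algebraic closure.\<close>

lemma simple_matrix_trace_nonzero:
  fixes A :: "'a::field^2^2"
  assumes "simple_matrix A" and s: "s\<^sup>2 = det A"
  shows "trace A + 2 * s \<noteq> 0"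
proof
  assume 0: "trace A + 2 * s = 0"
  then have tr: "trace A = - (2 * s)" by (simp add: eq_neg_iff_add_eq_0)
  have root: "x = - to_ac s" if "poly (map_poly to_ac (charpoly A)) x = 0" for x :: "'a alg_closure"
  proof -
    have "(x + to_ac s)\<^sup>2 = 0"
      using that unfolding charpoly_2 tr s[symmetric]
      by (simp add: map_poly_pCons power2_eq_square algebra_simps mult_2)
    then show ?thesis by (simp add: eq_neg_iff_add_eq_0)
  qed
  from assms(1) show False unfolding simple_matrix_def using root by metis
qed

text \<open>In terms of the eigenvalues x, y of \<open>Y\<close> this is (x^2 + y^2) + 2xy = (x +
  y)^2.\<close>

lemma trace_square_2: "trace (Y ** Y) + 2 * det Y = (trace (Y :: 'a::field^2^2))\<^sup>2"
  by (simp add: trace_2 det_2 matrix_matrix_mult_def sum_2 power2_eq_square algebra_simps)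

lemma square_root_det_2_nonzero:
  fixes A :: "'a::field^2^2"
  assumes s: "s\<^sup>2 = det A" and t: "t\<^sup>2 = trace A + 2 * s" and "t \<noteq> 0"
  shows "\<exists>Y. det Y = s \<and> Y ** Y = A"
proof -
  define a b c d where "a = A$1$1" and "b = A$1$2" and "c = A$2$1" and "d = A$2$2"
  note abcd = a_def[symmetric] b_def[symmetric] c_def[symmetric] d_def[symmetric]
  have s': "s * s = a * d - b * c" using s by (simp add: det_2 abcd power2_eq_square)
  have t': "t * t = a + d + 2 * s" using t by (simp add: trace_2 abcd power2_eq_square)
  let ?Y = "vector [vector [(a + s) / t, b / t], vector [c / t, (d + s) / t]] :: 'a^2^2"
  have "det ?Y = ((a + s) * (d + s) - b * c) / (t * t)"
    by (simp add: det_2 diff_divide_distrib)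
  also have "(a + s) * (d + s) - b * c = (a * d - b * c) + s * s + s * (a + d)"
    by (simp add: algebra_simps)
  also have "\<dots> = s * (t * t)"
    unfolding t' s'[symmetric] by (simp add: algebra_simps)
  finally have "det ?Y = s" using \<open>t \<noteq> 0\<close> by simp
  moreover have "?Y ** ?Y = A"
  proof -
    \<comment> \<open>The determinant relation is needed on the diagonal only: eliminating
      \<open>b * c\<close> cancels s^2 and leaves the factor a + d + 2s = t^2. Off the diagonal that
      factor appears directly.\<close>
    have "b * c = a * d - s * s" "c * b = a * d - s * s" using s' by (simp_all add: mult.commute)
    then have "(a + s) * (a + s) + b * c = a * (t * t)" "c * b + (d + s) * (d + s) = d * (t * t)"
      by (simp_all only: t') (simp_all add: algebra_simps)
    moreover have "(a + s) * b + b * (d + s) = b * (t * t)" "c * (a + s) + (d + s) * c = c * (t * t)"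
      unfolding t' by (simp_all add: algebra_simps)
    ultimately show ?thesis
      using \<open>t \<noteq> 0\<close>
      by (simp add: mat2_eq_iff matrix_matrix_mult_def sum_2 abcd divide_eq_eq
          add_divide_distrib[symmetric])
  qed
  ultimately show ?thesis by blast
qed

lemma square_root_det_2_iff:
  fixes A :: "'a::field^2^2"
  assumes A: "simple_matrix A \<or> scalar_matrix A" and s: "s\<^sup>2 = det A" and "s \<noteq> 0"
  shows "(\<exists>Y. det Y = s \<and> Y ** Y = A) \<longleftrightarrow> quadratic_element (trace A + 2 * s) \<or> trace A + 2 * s = 0"
    (is "?L \<longleftrightarrow> ?R")
proof
  assume ?L
  then obtain Y where "det Y = s" "Y ** Y = A" by blast
  then have "trace A + 2 * s = (trace Y)\<^sup>2" using trace_square_2[of Y] by simp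
  then show ?R unfolding quadratic_element_def by metis
next
  assume ?R
  then consider "trace A + 2 * s = 0" | t where "t\<^sup>2 = trace A + 2 * s" "t \<noteq> 0"
    unfolding quadratic_element_def by (metis zero_power2)
  then show ?L
  proof cases
    case 1
    then obtain c where c: "A = mat c"
      using A simple_matrix_trace_nonzero[OF _ s] by (auto simp: scalar_matrix_def)
    have "2 * (c + s) = 0" using 1 c by (simp add: trace_2 mat_def algebra_simps)
    moreover have "(c + s) * (c - s) = 0"
      using s c by (simp add: det_2 mat_def power2_eq_square algebra_simps)
    ultimately have "c = - s"
      \<comment> \<open>In characteristic 2 only the second equation is informative, and there \<open>s = - s\<close>.\<close>
      by (metis add.commute add_eq_0_iff eq_iff_diff_eq_0 mult_2 mult_eq_0_iff mult_zero_left)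
    \<comment> \<open>Up to signs a companion matrix: its characteristic polynomial is x^2 + s, so
      it squares to -s E.\<close>
    let ?Y = "vector [vector [0, s], vector [- 1, 0]] :: 'a^2^2"
    have "det ?Y = s" "?Y ** ?Y = A"
      using c \<open>c = - s\<close> by (simp_all add: det_2 mat2_eq_iff matrix_matrix_mult_def sum_2 mat_def)
    then show ?thesis by blast
  next
    case 2
    then show ?thesis using square_root_det_2_nonzero[OF s] by blast
  qed
qed

text \<open>The clause on roots in \<open>ESL2 - SL2\<close> quantifies over all roots in
  \<open>ESL2\<close>: the mere existence of one outside \<open>SL2\<close> does not stop
  \<open>trace A + 2\<close> from being a square, as \<open>A = mat 1\<close> shows when 2 \<noteq>
  0.\<close>

theorem theorem4:
  fixes A :: "'a::field^2^2"
  assumes "simple_matrix A \<or> scalar_matrix A"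
  shows
    "(A \<in> SL2 \<longrightarrow>
       ((\<exists>Y \<in> SL2. Y ** Y = A) \<longleftrightarrow> quadratic_element (trace A + 2) \<or> trace A + 2 = 0) \<and>
       ((\<exists>Y \<in> ESL2. Y ** Y = A) \<longleftrightarrow>
          (quadratic_element (trace A + 2) \<or> trace A + 2 = 0) \<or>
          (quadratic_element (trace A - 2) \<or> trace A - 2 = 0)) \<and>
       ((\<exists>Y \<in> ESL2. Y ** Y = A) \<and> (\<forall>Y \<in> ESL2. Y ** Y = A \<longrightarrow> Y \<in> ESL2 - SL2) \<longleftrightarrow>
          (quadratic_element (trace A - 2) \<or> trace A - 2 = 0) \<and>
          \<not> (quadratic_element (trace A + 2) \<or> trace A + 2 = 0)) \<and>
       (trace A + 2 \<noteq> 0 \<longrightarrow>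
          ((\<exists>Y \<in> SL2. Y ** Y = A) \<longleftrightarrow> quadratic_element (trace A + 2))) \<and>
       ((2 :: 'a) \<noteq> 0 \<and> trace A + 2 \<noteq> 0 \<and> trace A - 2 \<noteq> 0 \<longrightarrow>
          ((\<exists>Y \<in> ESL2 - SL2. Y ** Y = A) \<and> (\<exists>Y \<in> SL2. Y ** Y = A) \<longleftrightarrow>
             quadratic_element (trace A + 2) \<and> quadratic_element (trace A - 2)))) \<and>
     (A \<in> GL2 \<longrightarrow>
       ((\<exists>Y \<in> GL2. Y ** Y = A) \<longleftrightarrow>
          (\<exists>s. s\<^sup>2 = det A \<and>
             ((quadratic_element (trace A + 2 * s) \<or> trace A + 2 * s = 0) \<or>
              (quadratic_element (trace A - 2 * s) \<or> trace A - 2 * s = 0))) \<and>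
          quadratic_element (det A)))"
proof (intro conjI[where P = "A \<in> SL2 \<longrightarrow> _"] impI)
  assume "A \<in> SL2"
  then have det: "det A = 1" by (simp add: SL2_def)
  let ?root = "\<lambda>s. \<exists>Y. det Y = s \<and> Y ** Y = A"
  have plus: "?root 1 \<longleftrightarrow> quadratic_element (trace A + 2) \<or> trace A + 2 = 0"
    using square_root_det_2_iff[OF assms, of 1] det by simp
  have minus: "?root (- 1) \<longleftrightarrow> quadratic_element (trace A - 2) \<or> trace A - 2 = 0"
    using square_root_det_2_iff[OF assms, of "- 1"] det by simp
  have SL2: "Y \<in> SL2 \<longleftrightarrow> det Y = 1" for Y :: "'a^2^2"
    by (auto simp: SL2_def GL2_iff_det)
  have ESL2: "Y \<in> ESL2 \<longleftrightarrow> det Y = 1 \<or> det Y = - 1" for Y :: "'a^2^2"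
    by (auto simp: ESL2_def GL2_iff_det)
  have "(2 :: 'a) \<noteq> 0 \<Longrightarrow> (1 :: 'a) \<noteq> - 1"
    by (metis add.right_inverse one_add_one)
  then have diff: "(2 :: 'a) \<noteq> 0 \<Longrightarrow> Y \<in> ESL2 - SL2 \<longleftrightarrow> det Y = - 1" for Y :: "'a^2^2"
    by (auto simp: SL2 ESL2)
  have a: "(\<exists>Y \<in> SL2. Y ** Y = A) \<longleftrightarrow> ?root 1" by (auto simp: SL2)
  have b: "(\<exists>Y \<in> ESL2. Y ** Y = A) \<longleftrightarrow> ?root 1 \<or> ?root (- 1)" by (auto simp: ESL2)
  \<comment> \<open>If 1 = -1, both sides are false, so this holds in every characteristic.\<close>
  have c: "(\<exists>Y \<in> ESL2. Y ** Y = A) \<and> (\<forall>Y \<in> ESL2. Y ** Y = A \<longrightarrow> Y \<in> ESL2 - SL2) \<longleftrightarrow>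
      ?root (- 1) \<and> \<not> ?root 1"
    unfolding b by (auto simp: SL2 ESL2)
  have e: "(\<exists>Y \<in> ESL2 - SL2. Y ** Y = A) \<longleftrightarrow> ?root (- 1)" if "(2 :: 'a) \<noteq> 0"
    using diff[OF that] by blast
  show "((\<exists>Y \<in> SL2. Y ** Y = A) \<longleftrightarrow> quadratic_element (trace A + 2) \<or> trace A + 2 = 0) \<and>
       ((\<exists>Y \<in> ESL2. Y ** Y = A) \<longleftrightarrow>
          (quadratic_element (trace A + 2) \<or> trace A + 2 = 0) \<or>
          (quadratic_element (trace A - 2) \<or> trace A - 2 = 0)) \<and>
       ((\<exists>Y \<in> ESL2. Y ** Y = A) \<and> (\<forall>Y \<in> ESL2. Y ** Y = A \<longrightarrow> Y \<in> ESL2 - SL2) \<longleftrightarrow>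
          (quadratic_element (trace A - 2) \<or> trace A - 2 = 0) \<and>
          \<not> (quadratic_element (trace A + 2) \<or> trace A + 2 = 0)) \<and>
       (trace A + 2 \<noteq> 0 \<longrightarrow>
          ((\<exists>Y \<in> SL2. Y ** Y = A) \<longleftrightarrow> quadratic_element (trace A + 2))) \<and>
       ((2 :: 'a) \<noteq> 0 \<and> trace A + 2 \<noteq> 0 \<and> trace A - 2 \<noteq> 0 \<longrightarrow>
          ((\<exists>Y \<in> ESL2 - SL2. Y ** Y = A) \<and> (\<exists>Y \<in> SL2. Y ** Y = A) \<longleftrightarrow>
             quadratic_element (trace A + 2) \<and> quadratic_element (trace A - 2)))"
    \<comment> \<open>What remains is propositional: the side conditions strike out the zero
      alternatives.\<close>
    unfolding c unfolding a b using plus minus e by argo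
next
  assume "A \<in> GL2"
  then have det: "det A \<noteq> 0" by (simp add: GL2_iff_det)
  \<comment> \<open>Here \<open>s\<close> is nonzero because its square \<open>det A\<close>
    is.\<close>
  have root: "(\<exists>Y. det Y = s \<and> Y ** Y = A) \<longleftrightarrow>
      quadratic_element (trace A + 2 * s) \<or> trace A + 2 * s = 0" if "s\<^sup>2 = det A" for s
    using square_root_det_2_iff[OF assms that] that det by fastforce
  have root': "(\<exists>Y. det Y = - s \<and> Y ** Y = A) \<longleftrightarrow>
      quadratic_element (trace A - 2 * s) \<or> trace A - 2 * s = 0" if "s\<^sup>2 = det A" for s
    using root[of "- s"] that by simp
  have sq: "(det Y)\<^sup>2 = det A" if "Y ** Y = A" for Y
    using that by (auto simp: det_mul power2_eq_square)
  have GL2: "Y \<in> GL2" if "Y ** Y = A" for Y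
    using sq[OF that] det by (auto simp: GL2_iff_det)
  show "(\<exists>Y \<in> GL2. Y ** Y = A) \<longleftrightarrow>
          (\<exists>s. s\<^sup>2 = det A \<and>
             ((quadratic_element (trace A + 2 * s) \<or> trace A + 2 * s = 0) \<or>
              (quadratic_element (trace A - 2 * s) \<or> trace A - 2 * s = 0))) \<and>
          quadratic_element (det A)" (is "?L \<longleftrightarrow> ?R")
  proof
    assume ?L
    then obtain Y where Y: "Y ** Y = A" by blast
    \<comment> \<open>The witness for \<open>s\<close> is \<open>det Y\<close>, which also exhibits
      \<open>det A\<close> as a nonzero square.\<close>
    show ?R
      using root[OF sq[OF Y]] sq[OF Y] Y det unfolding quadratic_element_def[of "det A"] by blast
  next
    assume ?R
    then obtain s where "s\<^sup>2 = det A"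
      "(\<exists>Y. det Y = s \<and> Y ** Y = A) \<or> (\<exists>Y. det Y = - s \<and> Y ** Y = A)"
      using root root' by metis
    then show ?L using GL2 by blast
  qed
qed

end
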